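(* For every prime $p>3$, $$\sum_{k=0}^{p-1}(3k+2)(-1)^k f_k \equiv 2p^2(2^p-1)^2 \pmod{p^5},$$ where $f_k=\sum_{j=0}^{k}\binom{k}{j}^3$ is the $k$-th Franel number.
   Context: The Franel numbers are defined for all nonnegative integers $k$ by $f_k=\sum_{j=0}^{k}\binom{k}{j}^3$. *)

theory Defs
  imports "HOL-Number_Theory.Number_Theory"
begin

definition franel :: "nat \<Rightarrow> nat" where
  "franel k = (\<Sum>j=0..k. (k choose j) ^ 3)"

end

theory Submission
  imports Defs "HOL-Computational_Algebra.Polynomial"
begin

text \<open>By the three-term recurrence of the Franel numbers, three times the sum over \<open>k < n\<close> equals
  \<open>(-1)\<^sup>n n\<^sup>2 (f\<^sub>n - 8 f\<^sub>n\<^sub>-\<^sub>1)\<close>, so it remains to know \<open>f\<^sub>p\<close> and \<open>f\<^sub>p\<^sub>-\<^sub>1\<close> modulo \<open>p\<^sup>3\<close>. The former is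
  \<open>2\<close>. For the latter, \<open>u = (-1)\<^sup>k (p - 1 choose k)\<close> is \<open>1\<close> modulo \<open>p\<close>, hence
  \<open>u\<^sup>3 \<equiv> 3 u\<^sup>2 - 3 u + 1\<close>, and the alternating sums of \<open>u\<^sup>2\<close>, \<open>u\<close> and \<open>1\<close> are known in closed form.
  Morley's congruence for the central binomial coefficient then gives
  \<open>f\<^sub>p\<^sub>-\<^sub>1 \<equiv> 3 z\<^sup>2 - 3 z + 1\<close> with \<open>z = 2\<^sup>p\<^sup>-\<^sup>1\<close>, and \<open>8 (3 z\<^sup>2 - 3 z + 1) - 2 = 6 (2 z - 1)\<^sup>2\<close>.\<close>

section \<open>The three-term recurrence and the closed form of the weighted sum\<close>

text \<open>Zeilberger's algorithm supplies the certificate \<open>P\<close>. The summands are written through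
  \<open>t k = (n + 1 choose k) / (n + 1)\<close>, in which all three binomials are polynomial for \<open>k \<le> n + 1\<close>,
  so no boundary cases arise.\<close>

lemma franel_recurrence:
  assumes "n \<ge> 1"
  shows "(real n + 1)\<^sup>2 * real (franel (n + 1)) =
    (7 * (real n)\<^sup>2 + 7 * real n + 2) * real (franel n) + 8 * (real n)\<^sup>2 * real (franel (n - 1))"
proof -
  define t where "t k = real ((n + 1) choose k) / (real n + 1)" for k
  define P where "P x = 4 * x ^ 3 - (18 * real n + 12) * x\<^sup>2 + (27 * (real n)\<^sup>2 + 39 * real n + 12) * x
    - (14 * (real n) ^ 3 + 32 * (real n)\<^sup>2 + 22 * real n + 4)" for x
  define G where "G k = (real k * t k) ^ 3 * P (real k)" for k
  have choose1: "real ((n + 1) choose k) = (real n + 1) * t k" for k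
    by (simp add: t_def)
  have choose0: "real (n choose k) = (real n + 1 - real k) * t k" if "k \<le> n + 1" for k
  proof -
    have "(n + 1 - k) * ((n + 1) choose k) = (n + 1) * (n choose k)"
      using binomial_absorb_comp[of "n + 1" k] by simp
    then have "real (n + 1 - k) * real ((n + 1) choose k) = real (n + 1) * real (n choose k)"
      unfolding of_nat_mult[symmetric] by (rule arg_cong)
    then have "(real n + 1 - real k) * real ((n + 1) choose k) = (real n + 1) * real (n choose k)"
      using that by (simp only: of_nat_diff of_nat_add of_nat_1)
    then show ?thesis
      unfolding t_def by (simp add: field_simps)
  qed
  have choose_m1: "real n * real ((n - 1) choose k) = (real n - real k) * (real n + 1 - real k) * t k"
    if "k \<le> n + 1" for k
  \<comment> \<open>At \<open>k = n + 1\<close> the natural subtraction \<open>n - k\<close> would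
    truncate; there the left binomial and the factor n + 1 - k both vanish.\<close>
  proof (cases "k = n + 1")
    case False
    have "(n - k) * (n choose k) = n * ((n - 1) choose k)"
      by (rule binomial_absorb_comp)
    then have "real (n - k) * real (n choose k) = real n * real ((n - 1) choose k)"
      unfolding of_nat_mult[symmetric] by (rule arg_cong)
    then have "(real n - real k) * real (n choose k) = real n * real ((n - 1) choose k)"
      using that False by (simp add: of_nat_diff)
    then show ?thesis
      using choose0[OF that] by simp
  qed (simp add: binomial_eq_0)
  have shift: "real (Suc k) * t (Suc k) = (real n + 1 - real k) * t k" if "k \<le> n + 1" for k
  proof -
    have "Suc k * ((n + 1) choose Suc k) = (n + 1) * (n choose k)"
      using Suc_times_binomial[of k n] by simp
    then have "real (Suc k) * real ((n + 1) choose Suc k) = real (n + 1) * real (n choose k)"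
      unfolding of_nat_mult[symmetric] by (rule arg_cong)
    then have "real (Suc k) * t (Suc k) = real (n choose k)"
      unfolding t_def by (simp only: times_divide_eq_right of_nat_add of_nat_1) simp
    then show ?thesis
      using choose0[OF that] by simp
  qed
  \<comment> \<open>The factor \<open>n\<close> turns 8 n^2 times the cube of the binomial of n - 1
    into 8 times the cube of the left side of \<open>choose_m1\<close>, so no division by n
    occurs.\<close>
  have step: "real n * ((real n + 1)\<^sup>2 * real ((n + 1) choose k) ^ 3
      - (7 * (real n)\<^sup>2 + 7 * real n + 2) * real (n choose k) ^ 3
      - 8 * (real n)\<^sup>2 * real ((n - 1) choose k) ^ 3) = G (Suc k) - G k" if "k \<le> n + 1" for k
  proof -
    have "real n * ((real n + 1)\<^sup>2 * real ((n + 1) choose k) ^ 3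
      - (7 * (real n)\<^sup>2 + 7 * real n + 2) * real (n choose k) ^ 3
      - 8 * (real n)\<^sup>2 * real ((n - 1) choose k) ^ 3) =
      real n * ((real n + 1)\<^sup>2 * real ((n + 1) choose k) ^ 3
      - (7 * (real n)\<^sup>2 + 7 * real n + 2) * real (n choose k) ^ 3)
      - 8 * (real n * real ((n - 1) choose k)) ^ 3"
      by (simp add: algebra_simps power2_eq_square power3_eq_cube)
    also have "\<dots> = ((real n + 1 - real k) * t k) ^ 3 * P (real k + 1) - (real k * t k) ^ 3 * P (real k)"
      unfolding choose_m1[OF that] choose0[OF that] choose1 P_def
      by (simp add: algebra_simps power2_eq_square power3_eq_cube)
    also have "\<dots> = G (Suc k) - G k"
      unfolding G_def shift[OF that] by (simp add: add.commute)
    finally show ?thesis .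
  qed
  have pad: "real (franel m) = (\<Sum>k\<le>n + 1. real (m choose k) ^ 3)" if "m \<le> n + 1" for m
  proof -
    have "(\<Sum>k\<le>n + 1. real (m choose k) ^ 3) = (\<Sum>k\<in>{0..m}. real (m choose k) ^ 3)"
      by (rule sum.mono_neutral_right) (use that in \<open>auto simp: binomial_eq_0\<close>)
    then show ?thesis
      by (simp add: franel_def)
  qed
  have pads: "real (franel (n + 1)) = (\<Sum>k\<le>n + 1. real ((n + 1) choose k) ^ 3)"
    "real (franel n) = (\<Sum>k\<le>n + 1. real (n choose k) ^ 3)"
    "real (franel (n - 1)) = (\<Sum>k\<le>n + 1. real ((n - 1) choose k) ^ 3)"
    by (rule pad, simp)+
  have "real n * ((real n + 1)\<^sup>2 * real (franel (n + 1))
      - (7 * (real n)\<^sup>2 + 7 * real n + 2) * real (franel n)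
      - 8 * (real n)\<^sup>2 * real (franel (n - 1))) =
    (\<Sum>k\<le>n + 1. real n * ((real n + 1)\<^sup>2 * real ((n + 1) choose k) ^ 3
      - (7 * (real n)\<^sup>2 + 7 * real n + 2) * real (n choose k) ^ 3
      - 8 * (real n)\<^sup>2 * real ((n - 1) choose k) ^ 3))"
    unfolding pads by (simp only: sum_distrib_left sum_subtractf right_diff_distrib)
  also have "\<dots> = (\<Sum>k\<le>n + 1. G (Suc k) - G k)"
    by (rule sum.cong[OF refl], rule step) simp
  also have "\<dots> = G (n + 2) - G 0"
    using sum_lessThan_telescope[of G "n + 2"] by (simp add: lessThan_Suc_atMost)
  \<comment> \<open>\<open>G 0\<close> vanishes through its factor k, and \<open>G (n + 2)\<close>
    because \<open>t (n + 2)\<close> contains a binomial coefficient beyond the end of its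
    row.\<close>
  also have "\<dots> = 0"
    by (simp add: G_def t_def binomial_eq_0)
  finally show ?thesis
    using assms by simp
qed

lemma weighted_franel_sum:
  assumes "n \<ge> 1"
  shows "3 * (\<Sum>k<n. (3 * int k + 2) * (-1) ^ k * int (franel k)) =
    (-1) ^ n * (int n)\<^sup>2 * (int (franel n) - 8 * int (franel (n - 1)))"
  using assms
proof (induction n rule: dec_induct)
  case base
  then show ?case by (simp add: franel_def)
next
  case (step n)
  have "of_int ((int n + 1)\<^sup>2 * int (franel (n + 1))) = (of_int
    ((7 * (int n)\<^sup>2 + 7 * int n + 2) * int (franel n) + 8 * (int n)\<^sup>2 * int (franel (n - 1))) :: real)"
    using franel_recurrence[OF step(1)] by simp
  then have rec: "(int n + 1)\<^sup>2 * int (franel (n + 1)) =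
    (7 * (int n)\<^sup>2 + 7 * int n + 2) * int (franel n) + 8 * (int n)\<^sup>2 * int (franel (n - 1))"
    by linarith
  have "(-1) ^ Suc n * (int (Suc n))\<^sup>2 * (int (franel (Suc n)) - 8 * int (franel (Suc n - 1))) =
    - ((-1) ^ n) * ((int n + 1)\<^sup>2 * int (franel (n + 1)) - 8 * (int n + 1)\<^sup>2 * int (franel n))"
    by (simp add: algebra_simps)
  \<comment> \<open>Since 8(n+1)^2 - (7n^2+7n+2) = n^2 + 3(3n+2), the coefficient of f_n splits into
    its old share and three times the new summand.\<close>
  also have "\<dots> = (-1) ^ n * (int n)\<^sup>2 * (int (franel n) - 8 * int (franel (n - 1)))
      + 3 * ((3 * int n + 2) * (-1) ^ n * int (franel n))"
    unfolding rec by (simp add: algebra_simps power2_eq_square)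
  finally show ?case
    using step.IH by (simp add: algebra_simps)
qed

section \<open>Franel numbers at p and p - 1 modulo p^3\<close>

text \<open>Compare the coefficients of X^(2m) in (1 - X)^(2m) (1 + X)^(2m) = (1 -
  X^2)^(2m).\<close>

lemma alternating_choose_square_sum:
  "(\<Sum>k\<le>2 * m. (-1) ^ k * int ((2 * m) choose k) ^ 2) = (-1) ^ m * int ((2 * m) choose m)"
proof -
  have "[:1, -1:] ^ (2 * m) * [:1, 1:] ^ (2 * m) = ([:1, -1:] * [:1, (1 :: int):]) ^ (2 * m)"
    by (simp only: power_mult_distrib)
  also have "[:1, -1:] * [:1, (1 :: int):] = monom (-1) 2 + 1"
    by (simp add: monom_altdef numeral_2_eq_2 one_pCons)
  also have "\<dots> ^ (2 * m) = (\<Sum>k\<le>2 * m. monom ((-1) ^ k * int ((2 * m) choose k)) (2 * k))"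
    by (subst binomial_ring) (simp add: monom_power of_nat_monom mult_monom mult.commute)
  finally have "coeff ([:1, -1:] ^ (2 * m) * [:1, (1 :: int):] ^ (2 * m)) (2 * m) =
    (\<Sum>k\<le>2 * m. if k = m then (-1) ^ k * int ((2 * m) choose k) else 0)"
    by (simp add: coeff_sum)
  moreover have "coeff ([:1, -1:] ^ (2 * m) * [:1, (1 :: int):] ^ (2 * m)) (2 * m) =
    (\<Sum>k\<le>2 * m. (-1) ^ k * int ((2 * m) choose k) ^ 2)"
    unfolding coeff_mult
    by (rule sum.cong) (auto simp: coeff_linear_poly_power binomial_symmetric[symmetric] power2_eq_square)
  ultimately show ?thesis
    by simp
qed

text \<open>By Pascal's rule, neighbours in row p - 1 add up to an inner entry of row p, a multiple
  of p. So the signed entries stay constant modulo p, starting from 1.\<close>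

lemma alternating_choose_prime_minus_1:
  assumes "prime p" "k < p"
  shows "[(-1) ^ k * int ((p - 1) choose k) = 1] (mod int p)"
  using assms(2)
proof (induction k)
  case (Suc k)
  have "p dvd (p choose Suc k)"
    using Suc.prems assms(1) by (intro dvd_choose_prime) auto
  moreover have "p choose Suc k = ((p - 1) choose k) + ((p - 1) choose Suc k)"
    using Suc.prems choose_reduce_nat[of p "Suc k"] by simp
  ultimately have "int p dvd int ((p - 1) choose k) + int ((p - 1) choose Suc k)"
    by (metis int_dvd_int_iff of_nat_add)
  then have "int p dvd (-1) ^ k * (int ((p - 1) choose k) + int ((p - 1) choose Suc k))"
    by (rule dvd_mult)
  moreover have "(-1) ^ k * (int ((p - 1) choose k) + int ((p - 1) choose Suc k)) =
    (-1) ^ k * int ((p - 1) choose k) - (-1) ^ Suc k * int ((p - 1) choose Suc k)"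
    by (simp add: algebra_simps)
  ultimately have "[(-1) ^ k * int ((p - 1) choose k) = (-1) ^ Suc k * int ((p - 1) choose Suc k)] (mod int p)"
    by (simp only: cong_iff_dvd_diff)
  then show ?case
    using Suc cong_trans cong_sym by (metis Suc_lessD)
qed auto

text \<open>Inner entries of row p are divisible by p, their cubes by p^3; only the two end terms
  survive.\<close>

lemma franel_prime:
  assumes "prime p"
  shows "[int (franel p) = 2] (mod int p ^ 3)"
proof -
  have "franel p = (\<Sum>j\<in>{0<..<p} \<union> {0, p}. (p choose j) ^ 3)"
    unfolding franel_def by (rule sum.cong) auto
  also have "\<dots> = (\<Sum>j\<in>{0<..<p}. (p choose j) ^ 3) + 2"
    using prime_gt_0_nat[OF assms] by (subst sum.union_disjoint) auto
  finally have "int (franel p) = (\<Sum>j\<in>{0<..<p}. int (p choose j) ^ 3) + 2"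
    by simp
  moreover have "int p ^ 3 dvd (\<Sum>j\<in>{0<..<p}. int (p choose j) ^ 3)"
    using assms by (intro dvd_sum dvd_power_same) (auto intro!: dvd_choose_prime)
  ultimately show ?thesis
    by (simp add: cong_iff_dvd_diff)
qed

lemma franel_prime_minus_1:
  assumes "prime p" "p = 2 * m + 1"
  shows "[int (franel (p - 1)) = 3 * ((-1) ^ m * int ((2 * m) choose m)) - 3 * 2 ^ (p - 1) + 1] (mod int p ^ 3)"
proof -
  define u where "u k = (-1) ^ k * int ((2 * m) choose k)" for k
  have sign: "(-1) ^ k * ((-1) ^ k * x) = x" for k and x :: int
    by (simp flip: mult.assoc power_mult_distrib)
  have "[int (franel (p - 1)) = (\<Sum>k\<le>2 * m. (-1) ^ k * (3 * u k ^ 2 - 3 * u k + 1))] (mod int p ^ 3)"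
  proof -
    have "int (franel (p - 1)) = (\<Sum>k\<le>2 * m. (-1) ^ k * u k ^ 3)"
      by (simp add: franel_def u_def assms(2) atLeast0AtMost power_mult_distrib sign
          power3_eq_cube mult_ac flip: power_mult)
    moreover have "[(-1) ^ k * u k ^ 3 = (-1) ^ k * (3 * u k ^ 2 - 3 * u k + 1)] (mod int p ^ 3)"
      if "k \<le> 2 * m" for k
    proof -
      have "int p dvd u k - 1"
        using alternating_choose_prime_minus_1[OF assms(1), of k] that assms(2)
        by (simp add: u_def cong_iff_dvd_diff)
      then have "int p ^ 3 dvd (-1) ^ k * (u k - 1) ^ 3"
        by (intro dvd_mult dvd_power_same)
      also have "(-1) ^ k * (u k - 1) ^ 3 = (-1) ^ k * u k ^ 3 - (-1) ^ k * (3 * u k ^ 2 - 3 * u k + 1)"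
        by (simp add: algebra_simps power2_eq_square power3_eq_cube)
      finally show ?thesis
        by (simp add: cong_iff_dvd_diff)
    qed
    ultimately show ?thesis
      by (metis (mono_tags, lifting) cong_sum atMost_iff)
  qed
  \<comment> \<open>The outer sign, left over from the cube, makes the squares alternate and cancels
    the sign of the linear term, which becomes an ordinary row sum.\<close>
  also have "(\<Sum>k\<le>2 * m. (-1) ^ k * (3 * u k ^ 2 - 3 * u k + 1)) =
    3 * (\<Sum>k\<le>2 * m. (-1) ^ k * int ((2 * m) choose k) ^ 2) - 3 * (\<Sum>k\<le>2 * m. int ((2 * m) choose k))
    + (\<Sum>k\<le>2 * m. (-1) ^ k)"
    by (simp add: u_def sum_distrib_left sum.distrib sum_subtractf algebra_simps
        power_mult_distrib flip: power_mult power_add)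
  also have "(\<Sum>k\<le>2 * m. int ((2 * m) choose k)) = 2 ^ (2 * m)"
    using choose_row_sum[of "2 * m"] by (metis of_nat_sum of_nat_power of_nat_numeral)
  also have "(\<Sum>k\<le>2 * m. (-1 :: int) ^ k) = 1"
    by (induction m) auto
  finally show ?thesis
    by (simp add: alternating_choose_square_sum assms(2))
qed

section \<open>Partial fractions and the reciprocal of the central binomial coefficient\<close>

text \<open>Pascal's rule writes the sum for n + 1 at x as the difference of the sums for n at x and
  at x + 1; hence the induction keeps \<open>x\<close> arbitrary.\<close>

lemma alternating_choose_div_sum:
  fixes x :: real
  assumes "\<And>k. k \<le> n \<Longrightarrow> x + real k \<noteq> 0"
  shows "(\<Sum>k\<le>n. (-1) ^ k * real (n choose k) / (x + real k)) = fact n / pochhammer x (Suc n)"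
  using assms
proof (induction n arbitrary: x)
  case (Suc n)
  have split: "(\<Sum>k\<le>Suc n. (-1) ^ k * real (Suc n choose k) / (x + real k)) =
    (\<Sum>k\<le>n. (-1) ^ k * real (n choose k) / (x + real k))
    - (\<Sum>k\<le>n. (-1) ^ k * real (n choose k) / (x + 1 + real k))"
  proof -
    have "(\<Sum>k\<le>n. (-1) ^ k * real (n choose k) / (x + real k)) =
      (\<Sum>k\<le>Suc n. (-1) ^ k * real (n choose k) / (x + real k))"
      by (simp add: binomial_eq_0)
    also have "\<dots> = 1 / x + (\<Sum>k\<le>n. (-1) ^ Suc k * real (n choose Suc k) / (x + real (Suc k)))"
      by (subst sum.atMost_Suc_shift) simp
    finally show ?thesis
      by (subst sum.atMost_Suc_shift)
        (simp add: sum_subtractf[symmetric] sum.distrib[symmetric] sum_negf[symmetric] diff_divide_distrib add_divide_distrib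
          algebra_simps)
  qed
  have nz: "x \<noteq> 0" "x + 1 + real n \<noteq> 0"
    using Suc.prems[of 0] Suc.prems[of "Suc n"] by (auto simp: algebra_simps)
  have poch: "pochhammer (x + 1) n \<noteq> 0"
  proof
    assume "pochhammer (x + 1) n = 0"
    then obtain k where "k < n" "x + 1 = - real k"
      by (auto simp: pochhammer_eq_0_iff)
    then show False
      using Suc.prems[of "Suc k"] by simp
  qed
  have "(\<Sum>k\<le>Suc n. (-1) ^ k * real (Suc n choose k) / (x + real k)) =
    fact n / pochhammer x (Suc n) - fact n / pochhammer (x + 1) (Suc n)"
    unfolding split using Suc.prems[of "Suc _"] Suc.prems
    by (subst (1 2) Suc.IH) (auto simp: algebra_simps)
  also have "pochhammer x (Suc n) = x * pochhammer (x + 1) n"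
    by (rule pochhammer_rec)
  also have "pochhammer (x + 1) (Suc n) = pochhammer (x + 1) n * (x + 1 + real n)"
    by (rule pochhammer_Suc)
  also have "fact n / (x * pochhammer (x + 1) n) - fact n / (pochhammer (x + 1) n * (x + 1 + real n)) =
    fact (Suc n) / (x * (pochhammer (x + 1) n * (x + 1 + real n)))"
  proof -
    define y where "y = x + 1 + real n"
    have "fact (Suc n) = (y - x) * fact n"
      by (simp add: y_def)
    then show ?thesis
      using nz poch unfolding y_def[symmetric] by (simp add: field_simps)
  qed
  also have "x * (pochhammer (x + 1) n * (x + 1 + real n)) = pochhammer x (Suc (Suc n))"
    unfolding pochhammer_rec[of x "Suc n"] pochhammer_Suc[of "x + 1" n] ..
  finally show ?case .
qed simp

text \<open>Partial fractions at \<open>x = - (m + 1 / 2)\<close>, where the summands for \<open>k\<close> and \<open>2 m + 1 - k\<close> agree.\<close>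

lemma central_binomial_reciprocal:
  "(\<Sum>k\<le>m. (-1) ^ k * real ((2 * m + 1) choose k) / (real (2 * m + 1) - 2 * real k)) =
    (-1) ^ m * 16 ^ m / (real (2 * m + 1) * real ((2 * m) choose m))"
proof -
  define x :: real where "x = - (real m + 1 / 2)"
  define h where "h k = (-1) ^ k * real ((2 * m + 1) choose k) / (x + real k)" for k
  have nz: "x + real k \<noteq> 0" for k
  proof
    assume "x + real k = 0"
    then have "real (2 * k) = real (2 * m + 1)"
      by (simp add: x_def)
    then have "2 * k = 2 * m + 1"
      by (simp only: of_nat_eq_iff)
    then show False
      by presburger
  qed
  \<comment> \<open>Reflection in the odd number 2m + 1 changes the sign of both the power of -1 and
    the denominator.\<close>
  have sym: "h (2 * m + 1 - k) = h k" if "k \<le> m" for k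
  proof -
    have "(-1 :: real) ^ (2 * m + 1 - k) = - ((-1) ^ k)"
      using that by (simp add: uminus_power_if)
    moreover have "(2 * m + 1) choose (2 * m + 1 - k) = (2 * m + 1) choose k"
      using that by (intro binomial_symmetric[symmetric]) auto
    moreover have "x + real (2 * m + 1 - k) = - (x + real k)"
      using that by (simp add: x_def of_nat_diff)
    ultimately show ?thesis
      by (simp add: h_def del: minus_add_distrib)
  qed
  have "(\<Sum>k\<in>{m + 1..2 * m + 1}. h k) = (\<Sum>k\<le>m. h (2 * m + 1 - k))"
    by (rule sum.reindex_bij_witness[of _ "\<lambda>k. 2 * m + 1 - k" "\<lambda>k. 2 * m + 1 - k"]) auto
  then have "(\<Sum>k\<in>{m + 1..2 * m + 1}. h k) = (\<Sum>k\<le>m. h k)"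
    using sym by simp
  moreover have "{..2 * m + 1} = {..m} \<union> {m + 1..2 * m + 1}"
    by auto
  then have "(\<Sum>k\<le>2 * m + 1. h k) = (\<Sum>k\<le>m. h k) + (\<Sum>k\<in>{m + 1..2 * m + 1}. h k)"
    by (simp only:) (rule sum.union_disjoint, auto)
  ultimately have "2 * (\<Sum>k\<le>m. h k) = fact (2 * m + 1) / pochhammer x (2 * (m + 1))"
    using alternating_choose_div_sum[of "2 * m + 1" x] nz by (simp add: h_def)
  \<comment> \<open>The factors run from -(m + 1/2) to m + 1/2 in unit steps; the negative half
    mirrors the positive one up to sign.\<close>
  also have "pochhammer x (2 * (m + 1)) = pochhammer x (m + 1) * pochhammer (1 / 2) (m + 1)"
    unfolding mult_2 pochhammer_product' by (simp add: x_def)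
  also have "pochhammer x (m + 1) = (-1) ^ (m + 1) * pochhammer (1 / 2) (m + 1)"
    unfolding x_def pochhammer_minus by simp
  also have "pochhammer (1 / 2 :: real) (m + 1) = (real (2 * m + 1) / 2) * (fact (2 * m) / (4 ^ m * fact m))"
  proof -
    have "(2 :: real) ^ (2 * m) = 4 ^ m"
      by (simp add: power_mult)
    then have "fact (2 * m) = 4 ^ m * pochhammer (1 / 2) m * (fact m :: real)"
      using fact_double[where 'a = real, of m] by (simp only:)
    then show ?thesis
      by (simp add: pochhammer_Suc field_simps)
  qed
  finally have half: "2 * (\<Sum>k\<le>m. h k) = fact (2 * m + 1) / ((-1) ^ (m + 1) *
    (real (2 * m + 1) / 2 * (fact (2 * m) / (4 ^ m * fact m))) *
    (real (2 * m + 1) / 2 * (fact (2 * m) / (4 ^ m * fact m))))" .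
  have choose: "real ((2 * m) choose m) = fact (2 * m) / (fact m * fact m)"
    by (subst binomial_fact) (auto simp: mult_2)
  have fact_odd: "fact (2 * m + 1) = real (2 * m + 1) * fact (2 * m)"
    by simp
  \<comment> \<open>\<open>N\<close>, \<open>F\<close>, \<open>q\<close>, \<open>f\<close>,
    \<open>s\<close> stand for 2m + 1, (2m)!, 4^m, m! and (-1)^m.\<close>
  have cancel: "N * F / (- s * (N / 2 * (F / (q * f))) * (N / 2 * (F / (q * f)))) =
    - 4 * (s * (q * q) / (N * (F / (f * f))))"
    if "N \<noteq> 0" "F \<noteq> 0" "f \<noteq> 0" "q \<noteq> 0" "s * s = 1" for N F f q s :: real
  proof -
    have "s = 1 \<or> s = -1"
      using \<open>s * s = 1\<close> by (simp add: square_eq_1_iff)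
    with that show ?thesis
      by (auto simp: field_simps)
  qed
  have sign: "(-1 :: real) ^ (m + 1) = - ((-1) ^ m)" and "(16 :: real) ^ m = 4 ^ m * 4 ^ m"
    by (simp_all flip: power_mult_distrib)
  then have "2 * (\<Sum>k\<le>m. h k) = - 4 * ((-1) ^ m * 16 ^ m / (real (2 * m + 1) * real ((2 * m) choose m)))"
    unfolding half choose fact_odd
    by (simp only:) (rule cancel, simp_all del: of_nat_add of_nat_mult flip: power_mult_distrib)
  moreover have "h k = - 2 * ((-1) ^ k * real ((2 * m + 1) choose k) / (real (2 * m + 1) - 2 * real k))" for k
  proof -
    have "x + real k = - ((real (2 * m + 1) - 2 * real k) / 2)"
      by (simp add: x_def field_simps)
    then show ?thesis
      by (simp add: h_def del: of_nat_add of_nat_mult)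
  qed
  then have "(\<Sum>k\<le>m. h k) =
    - 2 * (\<Sum>k\<le>m. (-1) ^ k * real ((2 * m + 1) choose k) / (real (2 * m + 1) - 2 * real k))"
    by (simp only: sum_distrib_left)
  ultimately show ?thesis
    by linarith
qed

section \<open>Power sums, localisation at p and Morley's congruence\<close>

text \<open>Since \<open>k \<mapsto> 2 k\<close> permutes the nonzero residues, the full power sum \<open>T\<close> satisfies
  \<open>4 T \<equiv> 2\<^sup>p\<^sup>-\<^sup>1 T \<equiv> T\<close>.\<close>

lemma sum_powers_half_cong_0:
  assumes "prime p" "p > 3" "p = 2 * m + 1"
  shows "int p dvd (\<Sum>k=1..m. int k ^ (p - 3))"
proof -
  define e where "e = p - 3"
  define T where "T = (\<Sum>k=1..p - 1. int k ^ e)"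
  have odd_p: "odd p" and even_e: "even e"
    using assms by (auto simp: e_def)
  have cop: "coprime 2 p"
    using odd_p by simp
  have inj: "inj_on (\<lambda>k. 2 * k mod p) {1..p - 1}"
  proof (rule inj_onI)
    fix a b assume ab: "a \<in> {1..p - 1}" "b \<in> {1..p - 1}" "2 * a mod p = 2 * b mod p"
    then have "[a = b] (mod p)"
      using cong_mult_lcancel_nat[OF cop, of a b] by (simp add: cong_def)
    then show "a = b"
      using ab by (auto simp: cong_def)
  qed
  have "(\<lambda>k. 2 * k mod p) ` {1..p - 1} \<subseteq> {1..p - 1}"
  proof
    fix y assume "y \<in> (\<lambda>k. 2 * k mod p) ` {1..p - 1}"
    then obtain k where k: "k \<in> {1..p - 1}" "y = 2 * k mod p"
      by auto
    have "\<not> p dvd k"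
      using k(1) by (auto dest: dvd_imp_le)
    then have "\<not> p dvd 2 * k"
      using cop by (simp add: coprime_dvd_mult_right_iff coprime_commute)
    then have "y \<noteq> 0"
      using k by (auto simp: dvd_eq_mod_eq_0)
    moreover have "y < p"
      using k assms by simp
    ultimately show "y \<in> {1..p - 1}"
      by auto
  qed
  then have "(\<lambda>k. 2 * k mod p) ` {1..p - 1} = {1..p - 1}"
    using inj by (intro card_subset_eq) (auto simp: card_image)
  then have "T = (\<Sum>k=1..p - 1. int (2 * k mod p) ^ e)"
    unfolding T_def using inj by (metis (no_types, lifting) sum.reindex_cong)
  also have "[\<dots> = (\<Sum>k=1..p - 1. 2 ^ e * int k ^ e)] (mod int p)"
  proof (rule cong_sum)
    fix k
    have "[int (2 * k mod p) = 2 * int k] (mod int p)"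
      by (simp add: cong_def zmod_int)
    from cong_pow[OF this, of e]
    show "[int (2 * k mod p) ^ e = 2 ^ e * int k ^ e] (mod int p)"
      by (simp add: power_mult_distrib)
  qed
  also have "(\<Sum>k=1..p - 1. 2 ^ e * int k ^ e) = 2 ^ e * T"
    by (simp add: T_def sum_distrib_left)
  finally have "[4 * T = 4 * (2 ^ e * T)] (mod int p)"
    by (rule cong_scalar_left)
  moreover have "[4 * (2 ^ e * T) = 1 * T] (mod int p)"
  proof -
    have "[2 ^ (p - 1) = 1] (mod p)"
      by (rule fermat_theorem[OF assms(1)]) (use assms(2) in \<open>auto dest: dvd_imp_le\<close>)
    then have "[(2 :: int) ^ (p - 1) = 1] (mod int p)"
      by (metis cong_int_iff of_nat_1 of_nat_numeral of_nat_power)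
    moreover have "(2 :: int) ^ (p - 1) = 4 * 2 ^ e"
    proof -
      have "p - 1 = e + 2"
        using assms by (simp add: e_def)
      then show ?thesis
        by simp
    qed
    ultimately show ?thesis
      by (metis cong_scalar_right mult.assoc)
  qed
  ultimately have "[4 * T = T] (mod int p)"
    by (simp add: cong_def)
  then have "int p dvd 3 * T"
    by (simp add: cong_iff_dvd_diff)
  moreover have "\<not> int p dvd 3"
    using assms(2) by (auto dest: zdvd_imp_le)
  ultimately have "int p dvd T"
    using assms(1) by (simp add: prime_dvd_mult_iff)
  \<comment> \<open>Folding the upper half by k -> p - k shows that T is twice the half sum modulo
    p, because the exponent is even.\<close>
  have "(\<Sum>k\<in>{m + 1..p - 1}. int k ^ e) = (\<Sum>k=1..m. int (p - k) ^ e)"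
    by (rule sum.reindex_bij_witness[of _ "\<lambda>k. p - k" "\<lambda>k. p - k"]) (use assms in auto)
  also have "[\<dots> = (\<Sum>k=1..m. int k ^ e)] (mod int p)"
  proof (rule cong_sum)
    fix k assume "k \<in> {1..m}"
    then have "int (p - k) - (- int k) = int p"
      using assms by (simp add: of_nat_diff)
    then have "[int (p - k) = - int k] (mod int p)"
      by (simp add: cong_iff_dvd_diff)
    from cong_pow[OF this, of e]
    show "[int (p - k) ^ e = int k ^ e] (mod int p)"
      using even_e by simp
  qed
  finally have "[T = (\<Sum>k=1..m. int k ^ e) + (\<Sum>k=1..m. int k ^ e)] (mod int p)"
  proof -
    have "T = (\<Sum>k=1..m. int k ^ e) + (\<Sum>k\<in>{m + 1..p - 1}. int k ^ e)"
      unfolding T_def using assms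
      by (subst sum.union_disjoint[symmetric]) (auto intro!: sum.cong)
    moreover assume "[(\<Sum>k\<in>{m + 1..p - 1}. int k ^ e) = (\<Sum>k=1..m. int k ^ e)] (mod int p)"
    ultimately show ?thesis
      by (simp only: cong_add_lcancel)
  qed
  with \<open>int p dvd T\<close> have "int p dvd 2 * (\<Sum>k=1..m. int k ^ e)"
    by (simp add: cong_dvd_iff)
  moreover have "\<not> int p dvd 2"
    using assms(2) by (auto dest: zdvd_imp_le)
  ultimately show ?thesis
    using assms(1) by (simp add: prime_dvd_mult_iff e_def)
qed

text \<open>Says that \<open>x\<close> lies in \<open>p\<int>\<^sub>(\<^sub>p\<^sub>)\<close>, the maximal ideal of the localisation of the integers at \<open>p\<close>.\<close>

definition local_dvd :: "nat \<Rightarrow> real \<Rightarrow> bool" where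
  "local_dvd p x \<longleftrightarrow> (\<exists>a b :: int. coprime b (int p) \<and> x * of_int b = of_int (int p * a))"

lemma local_dvdI:
  assumes "coprime b (int p)" "x * of_int b = of_int c" "int p dvd c"
  shows "local_dvd p x"
  using assms unfolding local_dvd_def by (metis dvdE)

lemma local_dvd_add:
  assumes "local_dvd p x" "local_dvd p y"
  shows "local_dvd p (x + y)"
proof -
  obtain a b c d where "coprime b (int p)" "x * of_int b = of_int (int p * a)"
    "coprime d (int p)" "y * of_int d = of_int (int p * c)"
    using assms unfolding local_dvd_def by blast
  then show ?thesis
    by (intro local_dvdI[of "b * d" _ _ "int p * (a * d + b * c)"]) (auto simp: algebra_simps)
qed

lemma local_dvd_sum:
  assumes "\<And>k. k \<in> A \<Longrightarrow> local_dvd p (f k)"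
  shows "local_dvd p (sum f A)"
proof -
  have "local_dvd p 0"
    by (rule local_dvdI[of 1 _ _ 0]) auto
  with assms show ?thesis
    by (induction A rule: infinite_finite_induct) (auto intro: local_dvd_add)
qed

text \<open>Modulo \<open>p\<close>, the terms of \<open>central_binomial_reciprocal\<close> with \<open>k > 0\<close> reduce to multiples of
  \<open>1 / k\<^sup>2 \<equiv> k\<^sup>p\<^sup>-\<^sup>3\<close>.\<close>

lemma morley_congruence:
  assumes "prime p" "p > 3" "p = 2 * m + 1"
  shows "[(-1) ^ m * int ((2 * m) choose m) = 4 ^ (p - 1)] (mod int p ^ 3)"
proof -
  \<comment> \<open>With C(p,k) = (p/k) C(p-1,k-1), the k-th term of
    \<open>central_binomial_reciprocal\<close> is p times \<open>e k\<close>.\<close>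
  define e where "e k = (-1) ^ k * real ((2 * m) choose (k - 1)) / (real k * (real p - 2 * real k))" for k
  have cop2: "coprime 2 (int p)"
    using assms by simp
  have denom: "real p - 2 * real k \<noteq> 0" if "k \<le> m" for k
    using that assms(3) by simp
  \<comment> \<open>Modulo p the signed binomial in \<open>e k\<close> is -1 and p - 2k is -2k, so
    \<open>e k\<close> reduces to 1/(2k^2), and Fermat turns 1/k^2 into k^(p-3).\<close>
  have "local_dvd p (e k - of_int (int k ^ (p - 3)) / 2)" if k: "k \<in> {1..m}" for k
  proof (rule local_dvdI)
    have cop: "coprime (int l) (int p)" if "l \<ge> 1" "l < p" for l
    proof -
      have "\<not> p dvd l"
        using that by (auto dest: dvd_imp_le)
      then have "coprime p l"
        by (rule prime_imp_coprime_nat[OF assms(1)])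
      then show ?thesis
        by (simp add: coprime_commute)
    qed
    have "coprime (int k) (int p)" "coprime (int (p - 2 * k)) (int p)"
      by (rule cop; use k assms(3) in auto)+
    then show "coprime (2 * (int k * int (p - 2 * k))) (int p)"
      using cop2 by simp
    have "p - 1 = Suc (Suc (p - 3))"
      using assms(2) by simp
    then have power: "int k ^ (p - 1) = int k * (int k * int k ^ (p - 3))"
      by simp
    have "of_int (int (p - 2 * k)) = real p - 2 * real k"
      using k assms(3) by (simp add: of_nat_diff)
    then show "(e k - of_int (int k ^ (p - 3)) / 2) * of_int (2 * (int k * int (p - 2 * k))) =
      of_int (2 * ((-1) ^ k * int ((2 * m) choose (k - 1)) + int k ^ (p - 1)) - int p * (int k * int k ^ (p - 3)))"
      using k denom[of k] unfolding power by (simp add: e_def field_simps)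
    have "k - 1 < p" "p - 1 = 2 * m"
      using k assms(3) by auto
    then have "[(-1) ^ (k - 1) * int ((2 * m) choose (k - 1)) = 1] (mod int p)"
      using alternating_choose_prime_minus_1[OF assms(1), of "k - 1"] by (simp only:)
    moreover have "(-1 :: int) ^ k = - ((-1) ^ (k - 1))"
      using k by (cases k) auto
    moreover have "[int k ^ (p - 1) = 1] (mod int p)"
    proof -
      have "[k ^ (p - 1) = 1] (mod p)"
        by (rule fermat_theorem[OF assms(1)]) (use k assms(3) in \<open>auto dest: dvd_imp_le\<close>)
      then show ?thesis
        by (metis cong_int_iff of_nat_1 of_nat_power)
    qed
    ultimately have "[int k ^ (p - 1) - (-1) ^ (k - 1) * int ((2 * m) choose (k - 1)) = 1 - 1] (mod int p)"
      by (intro cong_diff)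
    then have "int p dvd (-1) ^ k * int ((2 * m) choose (k - 1)) + int k ^ (p - 1)"
      using \<open>(-1 :: int) ^ k = _\<close> by (simp add: cong_0_iff)
    then show "int p dvd
      2 * ((-1) ^ k * int ((2 * m) choose (k - 1)) + int k ^ (p - 1)) - int p * (int k * int k ^ (p - 3))"
      by (intro dvd_diff dvd_mult[of _ _ 2] dvd_triv_left)
  qed
  then have "local_dvd p (\<Sum>k=1..m. e k - of_int (int k ^ (p - 3)) / 2)"
    by (rule local_dvd_sum)
  moreover have "local_dvd p ((\<Sum>k=1..m. of_int (int k ^ (p - 3))) / 2)"
    using sum_powers_half_cong_0[OF assms] cop2
    by (intro local_dvdI[of 2 _ _ "\<Sum>k=1..m. int k ^ (p - 3)"]) auto
  ultimately have "local_dvd p (\<Sum>k=1..m. e k)"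
    using local_dvd_add by (fastforce simp: sum_subtractf sum_divide_distrib)
  then obtain a b where b: "coprime b (int p)" "(\<Sum>k=1..m. e k) * of_int b = of_int (int p * a)"
    unfolding local_dvd_def by blast
  define c where "c = (-1) ^ m * int ((2 * m) choose m)"
  have c: "of_int c \<noteq> (0 :: real)" "real ((2 * m) choose m) = (-1) ^ m * of_int c"
    by (auto simp: c_def simp flip: mult.assoc power_mult_distrib)
  have "{..m} = insert 0 {1..m}"
    by auto
  \<comment> \<open>The term k = 0 alone has p in its denominator; after multiplication by p c it
    becomes the main term c.\<close>
  then have "(\<Sum>k\<le>m. (-1) ^ k * real (p choose k) / (real p - 2 * real k)) =
    1 / real p + (\<Sum>k=1..m. (-1) ^ k * real (p choose k) / (real p - 2 * real k))"
    by simp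
  also have "(\<Sum>k=1..m. (-1) ^ k * real (p choose k) / (real p - 2 * real k)) = (\<Sum>k=1..m. real p * e k)"
  proof (rule sum.cong)
    fix k assume k: "k \<in> {1..m}"
    then have "k * (p choose k) = p * ((2 * m) choose (k - 1))"
      using times_binomial_minus1_eq[of k p] assms(3) by simp
    then have "real k * real (p choose k) = real p * real ((2 * m) choose (k - 1))"
      unfolding of_nat_mult[symmetric] by (rule arg_cong)
    then have "real (p choose k) = real p * real ((2 * m) choose (k - 1)) / real k"
      using k by (simp add: field_simps)
    then show "(-1) ^ k * real (p choose k) / (real p - 2 * real k) = real p * e k"
      by (simp add: e_def)
  qed simp
  also have "(\<Sum>k=1..m. real p * e k) = real p * (\<Sum>k=1..m. e k)"
    by (simp add: sum_distrib_left)
  finally have "1 / real p + real p * (\<Sum>k=1..m. e k) = (-1) ^ m * 16 ^ m / (real p * ((-1) ^ m * of_int c))"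
    using central_binomial_reciprocal[of m] unfolding assms(3)[symmetric] c(2) by simp
  also have "\<dots> = 16 ^ m / (real p * of_int c)"
    by simp
  finally have "real p * of_int c * (1 / real p + real p * (\<Sum>k=1..m. e k)) = 16 ^ m"
    using c(1) assms(2) by simp
  then have "of_int c + real p ^ 2 * of_int c * (\<Sum>k=1..m. e k) = 16 ^ m"
    using assms(2) by (simp add: distrib_left power2_eq_square mult_ac)
  then have "16 ^ m - of_int c = real p ^ 2 * of_int c * (\<Sum>k=1..m. e k)"
    by linarith
  \<comment> \<open>The sum of the \<open>e k\<close> supplies the third factor p; multiplying by
    its denominator \<open>b\<close>, which is prime to p, returns to the integers.\<close>
  then have "(16 ^ m - of_int c) * of_int b = real p ^ 2 * of_int c * ((\<Sum>k=1..m. e k) * of_int b)"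
    by (simp only: mult.assoc)
  then have "of_int ((16 ^ m - c) * b) = (of_int (int p ^ 3 * (c * a)) :: real)"
    unfolding b(2) by (simp add: power2_eq_square power3_eq_cube)
  then have "int p ^ 3 dvd (16 ^ m - c) * b"
    by (metis of_int_eq_iff dvd_triv_left)
  then have "int p ^ 3 dvd 16 ^ m - c"
    using b(1) by (simp add: coprime_dvd_mult_left_iff coprime_commute)
  moreover have "(16 :: int) ^ m = 4 ^ (p - 1)"
    by (simp add: assms(3) power_mult)
  ultimately show ?thesis
    by (simp add: c_def cong_iff_dvd_diff dvd_diff_commute)
qed

section \<open>Assembly of the congruence modulo p^5\<close>

theorem theorem1p2:
  fixes p :: nat
  assumes "prime p" and "p > 3"
  shows "[(\<Sum>k=0..p-1. (3 * int k + 2) * (-1) ^ k * int (franel k))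
          = 2 * int p ^ 2 * (2 ^ p - 1) ^ 2] (mod (int p ^ 5))"
proof -
  define S where "S = (\<Sum>k=0..p-1. (3 * int k + 2) * (-1) ^ k * int (franel k))"
  define z :: int where "z = 2 ^ (p - 1)"
  have odd_p: "odd p"
    using assms by (intro prime_odd_nat) auto
  then obtain m where m: "p = 2 * m + 1"
    by (elim oddE)
  have "{0..p - 1} = {..<p}"
    using assms(2) by auto
  \<comment> \<open>The sign (-1)^p = -1 reverses the difference in
    \<open>weighted_franel_sum\<close>.\<close>
  then have S: "3 * S = int p ^ 2 * (8 * int (franel (p - 1)) - int (franel p))"
    using weighted_franel_sum[of p] odd_p assms(2) by (simp add: S_def algebra_simps)
  have "[int (franel (p - 1)) = 3 * ((-1) ^ m * int ((2 * m) choose m)) - 3 * z + 1] (mod int p ^ 3)"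
    unfolding z_def by (rule franel_prime_minus_1[OF assms(1) m])
  also have "[3 * ((-1) ^ m * int ((2 * m) choose m)) - 3 * z + 1 = 3 * 4 ^ (p - 1) - 3 * z + 1] (mod int p ^ 3)"
    by (intro cong_add cong_diff cong_scalar_left morley_congruence[OF assms m]) auto
  also have "(4 :: int) ^ (p - 1) = z ^ 2"
    by (simp add: z_def power2_eq_square flip: power_mult_distrib)
  finally have "[8 * int (franel (p - 1)) - int (franel p) = 8 * (3 * z ^ 2 - 3 * z + 1) - 2] (mod int p ^ 3)"
    by (intro cong_diff cong_scalar_left franel_prime assms(1))
  also have "8 * (3 * z ^ 2 - 3 * z + 1) - 2 = 6 * (2 * z - 1) ^ 2"
    by (simp add: power2_eq_square algebra_simps)
  also have "2 * z = 2 ^ p"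
    using assms(2) by (simp add: z_def flip: power_Suc)
  finally have "int p ^ 3 dvd 8 * int (franel (p - 1)) - int (franel p) - 6 * (2 ^ p - 1) ^ 2"
    by (simp add: cong_iff_dvd_diff)
  \<comment> \<open>The prefactor p^2 lifts the congruence from p^3 to p^5.\<close>
  then have "int p ^ 2 * int p ^ 3 dvd
    int p ^ 2 * (8 * int (franel (p - 1)) - int (franel p) - 6 * (2 ^ p - 1) ^ 2)"
    by (rule mult_dvd_mono[OF dvd_refl])
  also have "\<dots> = 3 * (S - 2 * int p ^ 2 * (2 ^ p - 1) ^ 2)"
    using S by (simp add: algebra_simps)
  finally have "int p ^ 5 dvd 3 * (S - 2 * int p ^ 2 * (2 ^ p - 1) ^ 2)"
    by (simp flip: power_add)
  \<comment> \<open>As p > 3, the factor 3 brought in by \<open>weighted_franel_sum\<close> can be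
    cancelled.\<close>
  moreover have "coprime (int p ^ 5) 3"
    using assms primes_coprime[of p 3] by (simp add: coprime_int_iff[of p 3, simplified])
  ultimately have "int p ^ 5 dvd S - 2 * int p ^ 2 * (2 ^ p - 1) ^ 2"
    by (simp only: coprime_dvd_mult_right_iff)
  then show ?thesis
    by (simp add: S_def cong_iff_dvd_diff)
qed

end
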